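(* Let $B$ be a nonzero real constant and let $x=f(y)=y\ln(By)e^y$, defined for real $y$ with $By>0$. Then the branches of the logarithmic Lambert function $y=W_{\mathcal{L}}(x)$ can be described as follows. 1. When $B>0$, the equation $$(y+1)\ln(By)=-1$$ has a unique solution $y=\delta$, and the branches are: - $W^0_{\mathcal{L}}(x) : [f(\delta),+\infty)\to [\delta,+\infty)$, which is strictly increasing; - $W^1_{\mathcal{L}}(x) : (f(\delta),0)\to (0,\delta)$, which is strictly decreasing. 2. When $B<0$, the equation $(y+1)\ln(By)=-1$ has exactly two solutions $\delta_1,\delta_2$, which satisfy $\delta_1<\frac{1}{B}<\delta_2<0$, and the branches are: - $W^0_{\mathcal{L},<}(x) : (0, f(\delta_2)]\to [\delta_2,0)$, which is strictly decreasing; - $W^1_{\mathcal{L},<}(x) : [f(\delta_1),f(\delta_2)]\to [\delta_1,\delta_2]$, which is strictly increasing; - $W^2_{\mathcal{L},<}(x) : [f(\delta_1),0)\to (-\infty,\delta_1]$, which is strictly decreasing.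
   Context: For a real constant $B\ne 0$, the logarithmic Lambert function $y=W_{\mathcal{L}}(x)$ is defined as the (possibly multivalued) solution $y$ of the equation $y\ln(By)e^{y}=x$, where $x$ is real and $y$ is real with $By>0$ (in particular $y\neq0$). A branch, written $W:D\to R$ with domain $D$ and range $R$, is the inverse of the bijective restriction $f|_R:R\to D$, i.e. $W$ maps $D$ onto $R$ and $f(W(x))=x$ for all $x\in D$. The listed branches together account for all solutions. *)

theory Defs
  imports Complex_Main
begin

(* The real ln is total in HOL, so the condition B * y > 0 is never implicit:
   it is the domain of the function f and has to be imposed separately. *)
definition log_lambert_dom :: "real \<Rightarrow> real set" where
  "log_lambert_dom B = {y. B * y > 0}"

definition log_lambert_fun :: "real \<Rightarrow> real \<Rightarrow> real" where
  "log_lambert_fun B y = y * ln (B * y) * exp y"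

(* The multivalued logarithmic Lambert function: all values at x. *)
definition log_lambert :: "real \<Rightarrow> real \<Rightarrow> real set" where
  "log_lambert B x = {y \<in> log_lambert_dom B. log_lambert_fun B y = x}"

(* W : D \<rightarrow> R is the inverse of the bijective restriction f|R : R \<rightarrow> D.
   Values of W outside D are irrelevant. *)
definition log_lambert_branch ::
    "real \<Rightarrow> (real \<Rightarrow> real) \<Rightarrow> real set \<Rightarrow> real set \<Rightarrow> bool" where
  "log_lambert_branch B W D R \<longleftrightarrow>
     R \<subseteq> log_lambert_dom B \<and>
     bij_betw (log_lambert_fun B) R D \<and>
     W ` D = R \<and>
     (\<forall>x\<in>D. log_lambert_fun B (W x) = x)"

end

theory Submission
  imports Defs "HOL-Real_Asymp.Real_Asymp"
begin

text \<open>
The derivative of \<open>f y = y * ln (B * y) * exp y\<close> is \<open>exp y * g y\<close> with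
\<open>g y = (y + 1) * ln (B * y) + 1\<close>, so the equation of the theorem says exactly that \<open>y\<close> is a
critical point of \<open>f\<close>. The branches are the inverses of \<open>f\<close> on the intervals between consecutive
critical points and the ends of the domain; since these intervals cover the domain, the branches
together give every solution.

The sign of \<open>g\<close> is not visible directly, because \<open>g\<close> itself need not be monotone. But
\<open>g y = (y + 1) * h y\<close> with \<open>h y = ln (B * y) + 1 / (y + 1)\<close>, and
\<open>h' y = 1 / y - 1 / (y + 1)\<^sup>2\<close> is positive for \<open>y > 0\<close> and negative for \<open>y < 0\<close>.
For \<open>B > 0\<close>, \<open>h\<close> increases through a single zero. For \<open>B < 0\<close>, the pole of \<open>h\<close> at \<open>-1\<close> cuts the domain
into two intervals, on each of which \<open>h\<close> decreases from positive to negative values; this gives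
the two zeros, and \<open>g (-1) = 1\<close> fills the gap between the pieces. As \<open>g (1 / B) = 1\<close>, the position of
\<open>1 / B\<close> relative to the zeros follows from the signs of \<open>g\<close> (critical_point_pos,
critical_points_neg).

The domain of each branch is the image under \<open>f\<close> of an interval of monotonicity. By the intermediate
value theorem it is determined by the values at the included end points and by the limits at the
others: \<open>f\<close> tends to \<open>0\<close> as \<open>y\<close> tends to \<open>0\<close> and as \<open>y\<close> tends to minus infinity, and, for \<open>B > 0\<close>,
to infinity as \<open>y\<close> does. On an interval with such a limit \<open>0\<close>, \<open>f\<close> has constant sign and does not
attain \<open>0\<close>, because the interval does not contain \<open>1 / B\<close>, the only zero of the logarithm.
\<close>

section \<open>Consequences of the intermediate value theorem\<close>

lemma sign_change_of_increasing:
  fixes h h' :: "real \<Rightarrow> real"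
  assumes I: "connected I"
    and deriv: "\<And>y. y \<in> I \<Longrightarrow> (h has_real_derivative h' y) (at y)"
    and pos: "\<And>y. y \<in> I \<Longrightarrow> 0 < h' y"
    and a: "a \<in> I" "h a < 0" and b: "b \<in> I" "0 < h b"
  shows "\<exists>d\<in>I. h d = 0 \<and> (\<forall>y\<in>I. (y < d \<longrightarrow> h y < 0) \<and> (d < y \<longrightarrow> 0 < h y))"
proof -
  have mono: "h u < h v" if "u \<in> I" "v \<in> I" "u < v" for u v
  proof (rule DERIV_pos_imp_increasing[OF \<open>u < v\<close>])
    fix y assume "u \<le> y" "y \<le> v"
    then have "y \<in> I" using connectedD_interval[OF I that(1,2)] by blast
    then show "\<exists>z. (h has_real_derivative z) (at y) \<and> 0 < z"
      using deriv pos by blast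
  qed
  have "continuous_on I h"
    using deriv by (meson DERIV_isCont continuous_at_imp_continuous_on)
  then have "connected (h ` I)" using I by (rule connected_continuous_image)
  then have "0 \<in> h ` I"
    using a b by (auto intro: connectedD_interval[of "h ` I" "h a" "h b"])
  then obtain d where d: "d \<in> I" "h d = 0" by force
  have "(y < d \<longrightarrow> h y < 0) \<and> (d < y \<longrightarrow> 0 < h y)" if "y \<in> I" for y
    using mono[of y d] mono[of d y] d that by auto
  with d show ?thesis by blast
qed

text \<open>
This treats end points that belong to \<open>R\<close> and end points at which \<open>f\<close> only has a limit in the same
way: in either case the bracketing values are easy to exhibit.\<close>

lemma image_eq_if_values_bracketed:
  fixes f :: "real \<Rightarrow> real"
  assumes "connected R" "continuous_on R f" "f ` R \<subseteq> D"
    and "\<And>x. x \<in> D \<Longrightarrow> \<exists>u\<in>R. f u \<le> x" "\<And>x. x \<in> D \<Longrightarrow> \<exists>v\<in>R. x \<le> f v"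
  shows "f ` R = D"
proof
  show "f ` R \<subseteq> D" by (rule assms(3))
  have conn: "connected (f ` R)"
    by (rule connected_continuous_image[OF assms(2,1)])
  show "D \<subseteq> f ` R"
  proof
    fix x assume "x \<in> D"
    then obtain u v where uv: "u \<in> R" "f u \<le> x" "v \<in> R" "x \<le> f v"
      using assms(4)[of x] assms(5)[of x] by blast
    show "x \<in> f ` R"
      by (rule connectedD_interval[OF conn imageI[OF uv(1)] imageI[OF uv(3)] uv(2,4)])
  qed
qed

section \<open>Derivative and monotonicity\<close>

lemma log_lambert_dom_pos: "B > 0 \<Longrightarrow> log_lambert_dom B = {0<..}"
  by (auto simp: log_lambert_dom_def zero_less_mult_iff)

lemma log_lambert_dom_neg: "B < 0 \<Longrightarrow> log_lambert_dom B = {..<0}"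
  by (auto simp: log_lambert_dom_def zero_less_mult_iff)

lemma log_lambert_fun_deriv:
  assumes "y \<in> log_lambert_dom B"
  shows "(log_lambert_fun B has_real_derivative exp y * ((y + 1) * ln (B * y) + 1)) (at y)"
proof -
  have "0 < B * y" using assms by (simp add: log_lambert_dom_def)
  then show ?thesis
    unfolding log_lambert_fun_def[abs_def]
    by (auto intro!: derivative_eq_intros simp: field_simps)
qed

lemma log_lambert_fun_continuous_on:
  "R \<subseteq> log_lambert_dom B \<Longrightarrow> continuous_on R (log_lambert_fun B)"
  by (auto intro!: continuous_at_imp_continuous_on DERIV_isCont[OF log_lambert_fun_deriv])

text \<open>
The sign of the derivative is required strictly between two points of \<open>R\<close> only, so that \<open>R\<close> may
contain critical points as its end points.\<close>

lemma log_lambert_fun_increasing: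
  assumes R: "R \<subseteq> log_lambert_dom B" "connected R"
    and pos: "\<And>u v y. u \<in> R \<Longrightarrow> v \<in> R \<Longrightarrow> u < y \<Longrightarrow> y < v \<Longrightarrow> 0 < (y + 1) * ln (B * y) + 1"
  shows "strict_mono_on R (log_lambert_fun B)"
proof (rule strict_mono_onI)
  fix u v assume uv: "u \<in> R" "v \<in> R" "u < v"
  have sub: "{u..v} \<subseteq> R" using connectedD_interval[OF R(2) uv(1,2)] by auto
  show "log_lambert_fun B u < log_lambert_fun B v"
  proof (rule DERIV_pos_imp_increasing_open[OF \<open>u < v\<close>])
    fix y assume y: "u < y" "y < v"
    then have "y \<in> {u..v}" by simp
    then have "y \<in> log_lambert_dom B" using sub R(1) by blast
    then show "\<exists>z. (log_lambert_fun B has_real_derivative z) (at y) \<and> 0 < z"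
      using log_lambert_fun_deriv pos[OF uv(1,2) y]
      by (intro exI[of _ "exp y * ((y + 1) * ln (B * y) + 1)"]) simp
  qed (use sub R log_lambert_fun_continuous_on in blast)
qed

lemma log_lambert_fun_decreasing:
  assumes R: "R \<subseteq> log_lambert_dom B" "connected R"
    and neg: "\<And>u v y. u \<in> R \<Longrightarrow> v \<in> R \<Longrightarrow> u < y \<Longrightarrow> y < v \<Longrightarrow> (y + 1) * ln (B * y) + 1 < 0"
  shows "strict_antimono_on R (log_lambert_fun B)"
proof (rule monotone_onI)
  fix u v assume uv: "u \<in> R" "v \<in> R" "u < v"
  have sub: "{u..v} \<subseteq> R" using connectedD_interval[OF R(2) uv(1,2)] by auto
  show "log_lambert_fun B u > log_lambert_fun B v"
  proof (rule DERIV_neg_imp_decreasing_open[OF \<open>u < v\<close>])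
    fix y assume y: "u < y" "y < v"
    then have "y \<in> {u..v}" by simp
    then have "y \<in> log_lambert_dom B" using sub R(1) by blast
    then show "\<exists>z. (log_lambert_fun B has_real_derivative z) (at y) \<and> z < 0"
      using log_lambert_fun_deriv neg[OF uv(1,2) y]
      by (intro exI[of _ "exp y * ((y + 1) * ln (B * y) + 1)"]) (simp add: mult_pos_neg)
  qed (use sub R log_lambert_fun_continuous_on in blast)
qed

section \<open>Branches on intervals of monotonicity\<close>

text \<open>
The equivalence records that the solutions in \<open>R\<close> are exactly the values of the branch. Applied to
intervals that cover the domain of \<open>f\<close>, it shows that no solution is missed.\<close>

lemma branch_inverse:
  assumes "R \<subseteq> log_lambert_dom B" "inj_on (log_lambert_fun B) R" "log_lambert_fun B ` R = D"
  obtains W where "log_lambert_branch B W D R"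
    "\<And>x y. y \<in> R \<and> log_lambert_fun B y = x \<longleftrightarrow> x \<in> D \<and> y = W x"
proof -
  define W where "W = the_inv_into R (log_lambert_fun B)"
  have W: "W x \<in> R" "log_lambert_fun B (W x) = x" if "x \<in> D" for x
    using that assms(2,3) unfolding W_def
    by (simp_all add: f_the_inv_into_f the_inv_into_into)
  have "W ` D = R" unfolding W_def assms(3)[symmetric] using assms(2) by (rule the_inv_into_onto)
  with W(2) have branch: "log_lambert_branch B W D R"
    using assms(1-3) by (simp add: log_lambert_branch_def bij_betw_def)
  have left_inv: "W (log_lambert_fun B y) = y" if "y \<in> R" for y
    using assms(2) that unfolding W_def by (rule the_inv_into_f_f)
  have "y \<in> R \<and> log_lambert_fun B y = x \<longleftrightarrow> x \<in> D \<and> y = W x" for x y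
  proof
    assume "y \<in> R \<and> log_lambert_fun B y = x"
    then show "x \<in> D \<and> y = W x" unfolding assms(3)[symmetric] using left_inv by auto
  next
    assume "x \<in> D \<and> y = W x"
    then show "y \<in> R \<and> log_lambert_fun B y = x" using W[of x] by simp
  qed
  with branch show thesis by (rule that)
qed

lemma increasing_branch:
  assumes R: "R \<subseteq> log_lambert_dom B" and mono: "strict_mono_on R (log_lambert_fun B)"
    and D: "log_lambert_fun B ` R = D"
  obtains W where "log_lambert_branch B W D R" "strict_mono_on D W"
    "\<And>x y. y \<in> R \<and> log_lambert_fun B y = x \<longleftrightarrow> x \<in> D \<and> y = W x"
proof -
  obtain W where W: "log_lambert_branch B W D R"
    "\<And>x y. y \<in> R \<and> log_lambert_fun B y = x \<longleftrightarrow> x \<in> D \<and> y = W x"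
    using branch_inverse[OF R strict_mono_on_imp_inj_on[OF mono] D] by blast
  have "strict_mono_on D W"
  proof (rule strict_mono_onI, rule ccontr)
    fix x x' assume x: "x \<in> D" "x' \<in> D" "x < x'" and "\<not> W x < W x'"
    then have "log_lambert_fun B (W x') \<le> log_lambert_fun B (W x)"
      using W(2)[of "W x" x] W(2)[of "W x'" x'] by (intro strict_mono_on_leD[OF mono]) auto
    then show False using W(2)[of "W x" x] W(2)[of "W x'" x'] x by simp
  qed
  with W show thesis by (intro that)
qed

lemma decreasing_branch:
  assumes R: "R \<subseteq> log_lambert_dom B" and anti: "strict_antimono_on R (log_lambert_fun B)"
    and D: "log_lambert_fun B ` R = D"
  obtains W where "log_lambert_branch B W D R" "strict_antimono_on D W"
    "\<And>x y. y \<in> R \<and> log_lambert_fun B y = x \<longleftrightarrow> x \<in> D \<and> y = W x"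
proof -
  have less: "log_lambert_fun B v < log_lambert_fun B u" if "u \<in> R" "v \<in> R" "u < v" for u v
    using monotone_onD[OF anti that] .
  have "inj_on (log_lambert_fun B) R"
  proof (rule linorder_inj_onI')
    fix u v assume "u \<in> R" "v \<in> R" "u < v"
    then show "log_lambert_fun B u \<noteq> log_lambert_fun B v" using less[of u v] by simp
  qed
  then obtain W where W: "log_lambert_branch B W D R"
    "\<And>x y. y \<in> R \<and> log_lambert_fun B y = x \<longleftrightarrow> x \<in> D \<and> y = W x"
    using branch_inverse[OF R _ D] by blast
  have "strict_antimono_on D W"
  proof (rule monotone_onI, rule ccontr)
    fix x x' assume x: "x \<in> D" "x' \<in> D" "x < x'" and "\<not> W x' < W x"
    then show False
      using W(2)[of "W x" x] W(2)[of "W x'" x'] less[of "W x" "W x'"]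
      by (cases "W x" "W x'" rule: linorder_cases) auto
  qed
  with W show thesis by (intro that)
qed

section \<open>Critical points\<close>

lemma reduced_slope_deriv:
  assumes "y \<in> log_lambert_dom B" "y \<noteq> -1"
  shows "((\<lambda>y. ln (B * y) + 1 / (y + 1)) has_real_derivative 1 / y - 1 / (y + 1)\<^sup>2) (at y)"
proof -
  have "0 < B * y" "y + 1 \<noteq> 0" using assms by (auto simp: log_lambert_dom_def)
  then show ?thesis
    by (auto intro!: derivative_eq_intros simp: field_simps power2_eq_square)
qed

lemma slope_factor:
  fixes y :: real
  assumes "y \<noteq> -1"
  shows "(y + 1) * ln (B * y) + 1 = (y + 1) * (ln (B * y) + 1 / (y + 1))"
  using assms by (simp add: field_simps)

text \<open>
The function \<open>h\<close> increases on the positive half-line because \<open>(y + 1)\<^sup>2 > y\<close>; it is negative near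
\<open>0\<close>, where the logarithm dominates, and positive at \<open>1 / B\<close>, where the logarithm vanishes.\<close>

lemma critical_point_pos:
  fixes B :: real
  assumes "B > 0"
  obtains d where "0 < d" "d < 1 / B" "(d + 1) * ln (B * d) + 1 = 0"
    "\<And>y. 0 < y \<Longrightarrow> y < d \<Longrightarrow> (y + 1) * ln (B * y) + 1 < 0"
    "\<And>y. d < y \<Longrightarrow> 0 < (y + 1) * ln (B * y) + 1"
proof -
  let ?h = "\<lambda>y::real. ln (B * y) + 1 / (y + 1)"
  have "eventually (\<lambda>y. ?h y < 0 \<and> 0 < y) (at_right 0)"
    using assms by (intro eventually_conj) real_asymp+
  then obtain a where a: "a > 0" "?h a < 0"
    by (metis (mono_tags, lifting) eventually_happens trivial_limit_at_right_real)
  have pos: "0 < 1 / y - 1 / (y + 1)\<^sup>2" if "0 < y" for y :: real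
  proof -
    have "y < (y + 1)\<^sup>2"
      using that by (simp add: power2_eq_square algebra_simps add_pos_pos)
    then show ?thesis using that by (simp add: frac_less2)
  qed
  have b: "0 < ?h (1 / B)" using assms by (simp add: add_pos_pos)
  have "\<exists>d\<in>{0<..}. ?h d = 0 \<and> (\<forall>y\<in>{0<..}. (y < d \<longrightarrow> ?h y < 0) \<and> (d < y \<longrightarrow> 0 < ?h y))"
  proof (rule sign_change_of_increasing)
    show "(?h has_real_derivative 1 / y - 1 / (y + 1)\<^sup>2) (at y)" if "y \<in> {0<..}" for y
      using that assms by (intro reduced_slope_deriv) (auto simp: log_lambert_dom_pos)
    show "0 < 1 / y - 1 / (y + 1)\<^sup>2" if "y \<in> {0<..}" for y :: real
      using that by (intro pos) auto
    show "connected {0::real<..}" by (rule connected_Ioi)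
    show "a \<in> {0<..}" "?h a < 0" "1 / B \<in> {0<..}" "0 < ?h (1 / B)"
      using a b assms by auto
  qed
  then obtain d where d: "0 < d" "?h d = 0"
    "\<And>y. 0 < y \<Longrightarrow> y < d \<Longrightarrow> ?h y < 0" "\<And>y. 0 < y \<Longrightarrow> d < y \<Longrightarrow> 0 < ?h y"
    unfolding greaterThan_iff Ball_def Bex_def by blast
  have "d < 1 / B"
  proof (rule ccontr)
    assume "\<not> d < 1 / B"
    then have "?h (1 / B) \<le> 0"
      using d(2) d(3)[of "1 / B"] assms by (cases "d = 1 / B") auto
    with b show False by linarith
  qed
  with d show thesis
    by (intro that[of d]) (auto simp: slope_factor mult_pos_neg)
qed

text \<open>
Here \<open>-h\<close> is increasing on each side of the pole \<open>-1\<close> of \<open>h\<close>, and the limits of \<open>h\<close> at both ends of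
the two intervals provide the values of opposite sign. The factor \<open>y + 1\<close> changes sign at the pole
as well, so that the sign pattern of \<open>g\<close> is minus, plus, minus.\<close>

lemma critical_points_neg:
  fixes B :: real
  assumes "B < 0"
  obtains d1 d2 where "d1 < 1 / B" "1 / B < d2" "d2 < 0"
    "(d1 + 1) * ln (B * d1) + 1 = 0" "(d2 + 1) * ln (B * d2) + 1 = 0"
    "\<And>y. y < d1 \<Longrightarrow> (y + 1) * ln (B * y) + 1 < 0"
    "\<And>y. d1 < y \<Longrightarrow> y < d2 \<Longrightarrow> 0 < (y + 1) * ln (B * y) + 1"
    "\<And>y. d2 < y \<Longrightarrow> y < 0 \<Longrightarrow> (y + 1) * ln (B * y) + 1 < 0"
proof -
  let ?h = "\<lambda>y::real. ln (B * y) + 1 / (y + 1)"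
  have deriv: "((\<lambda>y. - ?h y) has_real_derivative - (1 / y - 1 / (y + 1)\<^sup>2)) (at y)"
    if "y < 0" "y \<noteq> -1" for y
    using that assms by (intro DERIV_minus reduced_slope_deriv) (auto simp: log_lambert_dom_neg)
  have pos: "0 < - (1 / y - 1 / (y + 1)\<^sup>2)" if "y < 0" "y \<noteq> -1" for y :: real
  proof -
    have "1 / y < 0" "0 < 1 / (y + 1)\<^sup>2" using that by auto
    then show ?thesis by linarith
  qed
  have "eventually (\<lambda>y. 0 < ?h y \<and> y < -1) at_bot"
    using assms by (intro eventually_conj) real_asymp+
  then obtain a1 where a1: "a1 < -1" "0 < ?h a1"
    by (metis (mono_tags, lifting) eventually_happens trivial_limit_at_bot_linorder)
  have "eventually (\<lambda>y. ?h y < 0 \<and> y < -1) (at_left (-1))"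
    using assms by (intro eventually_conj) real_asymp+
  then obtain b1 where b1: "b1 < -1" "?h b1 < 0"
    by (metis (mono_tags, lifting) eventually_happens trivial_limit_at_left_real)
  have "eventually (\<lambda>y. 0 < ?h y \<and> -1 < y \<and> y < 0) (at_right (-1))"
    using assms by (intro eventually_conj) real_asymp+
  then obtain a2 where a2: "-1 < a2" "a2 < 0" "0 < ?h a2"
    by (metis (mono_tags, lifting) eventually_happens trivial_limit_at_right_real)
  have "eventually (\<lambda>y. ?h y < 0 \<and> -1 < y \<and> y < 0) (at_left 0)"
    using assms by (intro eventually_conj) real_asymp+
  then obtain b2 where b2: "-1 < b2" "b2 < 0" "?h b2 < 0"
    by (metis (mono_tags, lifting) eventually_happens trivial_limit_at_left_real)
  have "\<exists>d\<in>{..<-1}. - ?h d = 0 \<and> (\<forall>y\<in>{..<-1}. (y < d \<longrightarrow> - ?h y < 0) \<and> (d < y \<longrightarrow> 0 < - ?h y))"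
  proof (rule sign_change_of_increasing)
    show "connected {..<-1::real}" by (rule connected_Iio)
    show "((\<lambda>y. - ?h y) has_real_derivative - (1 / y - 1 / (y + 1)\<^sup>2)) (at y)" if "y \<in> {..<-1}" for y
      using that by (intro deriv) auto
    show "0 < - (1 / y - 1 / (y + 1)\<^sup>2)" if "y \<in> {..<-1}" for y :: real
      using that by (intro pos) auto
    show "a1 \<in> {..<-1}" "- ?h a1 < 0" "b1 \<in> {..<-1}" "0 < - ?h b1"
      using a1 b1 by auto
  qed
  then obtain d1 where d1: "d1 \<in> {..<-1}" "- ?h d1 = 0"
    "\<And>y. y \<in> {..<-1} \<Longrightarrow> y < d1 \<Longrightarrow> - ?h y < 0"
    "\<And>y. y \<in> {..<-1} \<Longrightarrow> d1 < y \<Longrightarrow> 0 < - ?h y"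
    by blast
  have "\<exists>d\<in>{-1<..<0}. - ?h d = 0 \<and> (\<forall>y\<in>{-1<..<0}. (y < d \<longrightarrow> - ?h y < 0) \<and> (d < y \<longrightarrow> 0 < - ?h y))"
  proof (rule sign_change_of_increasing)
    show "connected {-1<..<0::real}" by (rule connected_Ioo)
    show "((\<lambda>y. - ?h y) has_real_derivative - (1 / y - 1 / (y + 1)\<^sup>2)) (at y)" if "y \<in> {-1<..<0}" for y
      using that by (intro deriv) auto
    show "0 < - (1 / y - 1 / (y + 1)\<^sup>2)" if "y \<in> {-1<..<0}" for y :: real
      using that by (intro pos) auto
    show "a2 \<in> {-1<..<0}" "- ?h a2 < 0" "b2 \<in> {-1<..<0}" "0 < - ?h b2"
      using a2 b2 by auto
  qed
  then obtain d2 where d2: "d2 \<in> {-1<..<0}" "- ?h d2 = 0"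
    "\<And>y. y \<in> {-1<..<0} \<Longrightarrow> y < d2 \<Longrightarrow> - ?h y < 0"
    "\<And>y. y \<in> {-1<..<0} \<Longrightarrow> d2 < y \<Longrightarrow> 0 < - ?h y"
    by blast
  have mid: "0 < (y + 1) * ln (B * y) + 1" if "d1 < y" "y < d2" for y
  proof (cases y "-1::real" rule: linorder_cases)
    case less
    then show ?thesis using d1(4)[of y] that(1) by (simp add: slope_factor mult_neg_neg)
  next
    case greater
    then show ?thesis using d2(1) d2(3)[of y] that(2) by (simp add: slope_factor)
    \<comment> \<open>At the pole \<open>y = -1\<close> of \<open>h\<close> the expression is simply \<open>1\<close>.\<close>
  qed simp
  have right: "(y + 1) * ln (B * y) + 1 < 0" if "d2 < y" "y < 0" for y
    using d2(4)[of y] that d2(1) by (simp add: slope_factor mult_pos_neg)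
  have left: "(y + 1) * ln (B * y) + 1 < 0" if "y < d1" for y
    using d1(3)[of y] that d1(1) by (simp add: slope_factor mult_neg_pos)
  have zero: "(d1 + 1) * ln (B * d1) + 1 = 0" "(d2 + 1) * ln (B * d2) + 1 = 0"
    using d1(1,2) d2(1,2) by (simp_all add: slope_factor)
  \<comment> \<open>The logarithm vanishes at \<open>1 / B\<close>, so the slope there is \<open>1\<close>, and only the middle interval
    admits a positive slope.\<close>
  define c where "c = 1 / B"
  have one: "(c + 1) * ln (B * c) + 1 = 1" and "c < 0" using assms by (simp_all add: c_def)
  have "d1 \<noteq> c" "d2 \<noteq> c" using zero one by (metis zero_neq_one)+
  moreover have "\<not> c < d1" "\<not> d2 < c"
    using left[of c] right[of c] one \<open>c < 0\<close> by linarith+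
  ultimately have "d1 < 1 / B" "1 / B < d2" unfolding c_def by linarith+
  moreover have "d2 < 0" using d2(1) by simp
  ultimately show thesis using zero left mid right that by blast
qed

section \<open>Description of the branches\<close>

lemma branches_pos:
  assumes B: "B > 0"
  defines "f \<equiv> log_lambert_fun B"
  shows
    "\<exists>\<delta>. {y \<in> log_lambert_dom B. (y + 1) * ln (B * y) = -1} = {\<delta>} \<and>
      (\<exists>W0 W1.
         log_lambert_branch B W0 {f \<delta>..} {\<delta>..} \<and>
         strict_mono_on {f \<delta>..} W0 \<and>
         log_lambert_branch B W1 {f \<delta><..<0} {0<..<\<delta>} \<and>
         strict_antimono_on {f \<delta><..<0} W1 \<and>
         (\<forall>x y. y \<in> log_lambert B x \<longleftrightarrow>
            (x \<in> {f \<delta>..} \<and> y = W0 x) \<or>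
            (x \<in> {f \<delta><..<0} \<and> y = W1 x)))"
proof -
  obtain d where d: "0 < d" "d < 1 / B" "(d + 1) * ln (B * d) + 1 = 0"
    "\<And>y. 0 < y \<Longrightarrow> y < d \<Longrightarrow> (y + 1) * ln (B * y) + 1 < 0"
    "\<And>y. d < y \<Longrightarrow> 0 < (y + 1) * ln (B * y) + 1"
    using critical_point_pos[OF B] by blast
  note dom = log_lambert_dom_pos[OF B]
  have crit: "{y \<in> log_lambert_dom B. (y + 1) * ln (B * y) = -1} = {d}"
    unfolding dom using d by (smt (verit, best) Collect_cong greaterThan_iff singleton_conv)
  have mono: "strict_mono_on {d..} f"
    unfolding f_def using d by (intro log_lambert_fun_increasing) (auto simp: dom)
  \<comment> \<open>The end point \<open>d\<close> is included in order to compare \<open>f d\<close> with the other values.\<close>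
  have anti: "strict_antimono_on {0<..d} f"
    unfolding f_def using d by (intro log_lambert_fun_decreasing) (auto simp: dom)
  have negative: "f y < 0" if "0 < y" "y < d" for y
  proof -
    have "y < 1 / B" using that(2) d(2) by linarith
    then have "B * y < 1" using B by (simp add: pos_less_divide_eq mult.commute)
    then show ?thesis using that B
      by (simp add: f_def log_lambert_fun_def mult_pos_neg mult_neg_pos)
  qed
  have im0: "f ` {d..} = {f d..}"
  proof (rule image_eq_if_values_bracketed)
    show "continuous_on {d..} f"
      unfolding f_def using d by (intro log_lambert_fun_continuous_on) (auto simp: dom)
    show "f ` {d..} \<subseteq> {f d..}"
      using mono by (auto simp: strict_mono_on_leD)
    have "filterlim f at_top at_top"
      unfolding f_def log_lambert_fun_def[abs_def] using B by real_asymp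
    then have "eventually (\<lambda>y. x \<le> f y) at_top" for x
      by (simp add: filterlim_at_top)
    then have near: "eventually (\<lambda>y. x \<le> f y \<and> d \<le> y) at_top" for x
      by (intro eventually_conj eventually_ge_at_top)
    show "\<exists>v\<in>{d..}. x \<le> f v" for x
    proof -
      obtain v where "x \<le> f v \<and> d \<le> v"
        using eventually_happens'[OF trivial_limit_at_top_linorder near[of x]] by auto
      then show ?thesis by (intro bexI[of _ v]) auto
    qed
  qed auto
  have im1: "f ` {0<..<d} = {f d<..<0}"
  proof (rule image_eq_if_values_bracketed)
    show "continuous_on {0<..<d} f"
      unfolding f_def by (intro log_lambert_fun_continuous_on) (auto simp: dom)
    show "f ` {0<..<d} \<subseteq> {f d<..<0}"
      using anti negative d(1) by (auto simp: monotone_on_def)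
    have lim0: "(f \<longlongrightarrow> 0) (at_right 0)"
      unfolding f_def log_lambert_fun_def[abs_def] using B by real_asymp
    have near: "eventually (\<lambda>y. x < f y \<and> y \<in> {0<..<d}) (at_right 0)" if "x < 0" for x
      by (rule eventually_conj[OF order_tendstoD(1)[OF lim0 that] eventually_at_right_real[OF d(1)]])
    show "\<exists>v\<in>{0<..<d}. x \<le> f v" if x: "x \<in> {f d<..<0}" for x
    proof -
      obtain v where "x < f v \<and> v \<in> {0<..<d}"
        using eventually_happens'[OF trivial_limit_at_right_real near[of x]] x by auto
      then show ?thesis by (intro bexI[of _ v]) auto
    qed
    have "isCont f d"
      unfolding f_def using d(1) by (intro DERIV_isCont[OF log_lambert_fun_deriv]) (simp add: dom)
    then have limd: "(f \<longlongrightarrow> f d) (at_left d)"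
      by (simp add: isCont_def filterlim_at_split)
    have near: "eventually (\<lambda>y. f y < x \<and> y \<in> {0<..<d}) (at_left d)" if "f d < x" for x
      by (rule eventually_conj[OF order_tendstoD(2)[OF limd that] eventually_at_left_real[OF d(1)]])
    show "\<exists>v\<in>{0<..<d}. f v \<le> x" if x: "x \<in> {f d<..<0}" for x
    proof -
      obtain v where "f v < x \<and> v \<in> {0<..<d}"
        using eventually_happens'[OF trivial_limit_at_left_real near[of x]] x by auto
      then show ?thesis by (intro bexI[of _ v]) auto
    qed
  qed auto
  have subs: "{d..} \<subseteq> log_lambert_dom B" "{0<..<d} \<subseteq> log_lambert_dom B"
    using d(1) by (auto simp: dom)
  obtain W0 where W0: "log_lambert_branch B W0 {f d..} {d..}" "strict_mono_on {f d..} W0"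
    "\<And>x y. y \<in> {d..} \<and> f y = x \<longleftrightarrow> x \<in> {f d..} \<and> y = W0 x"
    using increasing_branch[OF _ mono[unfolded f_def] im0[unfolded f_def], folded f_def] subs by blast
  have anti': "strict_antimono_on {0<..<d} f"
    using anti by (rule monotone_on_subset) auto
  obtain W1 where W1: "log_lambert_branch B W1 {f d<..<0} {0<..<d}" "strict_antimono_on {f d<..<0} W1"
    "\<And>x y. y \<in> {0<..<d} \<and> f y = x \<longleftrightarrow> x \<in> {f d<..<0} \<and> y = W1 x"
    using decreasing_branch[OF _ anti'[unfolded f_def] im1[unfolded f_def], folded f_def] subs by blast
  have cover: "(x \<in> {f d..} \<and> y = W0 x) \<or> (x \<in> {f d<..<0} \<and> y = W1 x) \<longleftrightarrow> y \<in> log_lambert B x"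
    for x y
    unfolding W0(3)[symmetric] W1(3)[symmetric]
    using d(1) by (auto simp: log_lambert_def dom f_def)
  show ?thesis
    by (rule exI[of _ d], rule conjI[OF crit], rule exI[of _ W0], rule exI[of _ W1],
        rule conjI[OF W0(1)], rule conjI[OF W0(2)], rule conjI[OF W1(1)], rule conjI[OF W1(2)],
        (rule allI)+, rule cover[symmetric])
qed

lemma branches_neg:
  assumes B: "B < 0"
  defines "f \<equiv> log_lambert_fun B"
  shows
    "\<exists>\<delta>1 \<delta>2. {y \<in> log_lambert_dom B. (y + 1) * ln (B * y) = -1} = {\<delta>1, \<delta>2} \<and>
      \<delta>1 < 1 / B \<and> 1 / B < \<delta>2 \<and> \<delta>2 < 0 \<and>
      (\<exists>W0 W1 W2.
         log_lambert_branch B W0 {0<..f \<delta>2} {\<delta>2..<0} \<and>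
         strict_antimono_on {0<..f \<delta>2} W0 \<and>
         log_lambert_branch B W1 {f \<delta>1..f \<delta>2} {\<delta>1..\<delta>2} \<and>
         strict_mono_on {f \<delta>1..f \<delta>2} W1 \<and>
         log_lambert_branch B W2 {f \<delta>1..<0} {..\<delta>1} \<and>
         strict_antimono_on {f \<delta>1..<0} W2 \<and>
         (\<forall>x y. y \<in> log_lambert B x \<longleftrightarrow>
            (x \<in> {0<..f \<delta>2} \<and> y = W0 x) \<or>
            (x \<in> {f \<delta>1..f \<delta>2} \<and> y = W1 x) \<or>
            (x \<in> {f \<delta>1..<0} \<and> y = W2 x)))"
proof -
  obtain d1 d2 where d: "d1 < 1 / B" "1 / B < d2" "d2 < 0"
    "(d1 + 1) * ln (B * d1) + 1 = 0" "(d2 + 1) * ln (B * d2) + 1 = 0"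
    "\<And>y. y < d1 \<Longrightarrow> (y + 1) * ln (B * y) + 1 < 0"
    "\<And>y. d1 < y \<Longrightarrow> y < d2 \<Longrightarrow> 0 < (y + 1) * ln (B * y) + 1"
    "\<And>y. d2 < y \<Longrightarrow> y < 0 \<Longrightarrow> (y + 1) * ln (B * y) + 1 < 0"
    using critical_points_neg[OF B] by blast
  note dom = log_lambert_dom_neg[OF B]
  have d12: "d1 < d2" "d1 < 0" using d(1-3) by auto
  have crit: "{y \<in> log_lambert_dom B. (y + 1) * ln (B * y) = -1} = {d1, d2}" (is "?C = _")
  proof -
    have "y \<in> ?C \<longleftrightarrow> y = d1 \<or> y = d2" for y
      unfolding dom using d12 d(3,4,5) d(6,7,8)[of y]
      by (cases y d1 rule: linorder_cases; cases y d2 rule: linorder_cases; cases "y < 0") auto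
    then show ?thesis by blast
  qed
  have anti0: "strict_antimono_on {d2..<0} f"
    unfolding f_def using d by (intro log_lambert_fun_decreasing) (auto simp: dom)
  have mono1: "strict_mono_on {d1..d2} f"
    unfolding f_def using d by (intro log_lambert_fun_increasing) (auto simp: dom)
  have anti2: "strict_antimono_on {..d1} f"
    unfolding f_def using d12 d by (intro log_lambert_fun_decreasing) (auto simp: dom)
  have positive: "0 < f y" if "d2 \<le> y" "y < 0" for y
  proof -
    have "1 / B < y" using that(1) d(2) by linarith
    then have "0 < B * y" "B * y < 1" using that(2) B by (simp_all add: field_simps zero_less_mult_iff)
    then show ?thesis using that(2)
      by (simp add: f_def log_lambert_fun_def mult_neg_neg)
  qed
  have negative: "f y < 0" if "y \<le> d1" for y
  proof -
    have "y < 1 / B" "y < 0" using that d(1) d12 by linarith+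
    then have "1 < B * y" using B by (simp add: field_simps)
    then show ?thesis using \<open>y < 0\<close>
      by (simp add: f_def log_lambert_fun_def mult_neg_pos)
  qed
  have im0: "f ` {d2..<0} = {0<..f d2}"
  proof (rule image_eq_if_values_bracketed)
    show "continuous_on {d2..<0} f"
      unfolding f_def by (intro log_lambert_fun_continuous_on) (auto simp: dom)
    show "f ` {d2..<0} \<subseteq> {0<..f d2}"
      using anti0 positive d(3) by (force simp: monotone_on_def less_eq_real_def)
    have lim0: "(f \<longlongrightarrow> 0) (at_left 0)"
      unfolding f_def log_lambert_fun_def[abs_def] using B by real_asymp
    have near: "eventually (\<lambda>y. f y < x \<and> y \<in> {d2<..<0}) (at_left 0)" if "0 < x" for x
      by (rule eventually_conj[OF order_tendstoD(2)[OF lim0 that] eventually_at_left_real[OF d(3)]])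
    show "\<exists>v\<in>{d2..<0}. f v \<le> x" if x: "x \<in> {0<..f d2}" for x
    proof -
      obtain v where "f v < x \<and> v \<in> {d2<..<0}"
        using eventually_happens'[OF trivial_limit_at_left_real near[of x]] x by auto
      then show ?thesis by (intro bexI[of _ v]) auto
    qed
    show "\<exists>v\<in>{d2..<0}. x \<le> f v" if "x \<in> {0<..f d2}" for x
      using that d(3) by (intro bexI[of _ d2]) auto
  qed auto
  have im1: "f ` {d1..d2} = {f d1..f d2}"
  proof (rule image_eq_if_values_bracketed)
    show "continuous_on {d1..d2} f"
      unfolding f_def using d(3) by (intro log_lambert_fun_continuous_on) (auto simp: dom)
    show "f ` {d1..d2} \<subseteq> {f d1..f d2}"
      using mono1 d12 by (auto simp: strict_mono_on_leD)
  qed (use d12 in \<open>auto intro: bexI[of _ d1] bexI[of _ d2]\<close>)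
  have im2: "f ` {..d1} = {f d1..<0}"
  proof (rule image_eq_if_values_bracketed)
    show "continuous_on {..d1} f"
      unfolding f_def using d12 by (intro log_lambert_fun_continuous_on) (auto simp: dom)
    show "f ` {..d1} \<subseteq> {f d1..<0}"
      using anti2 negative by (force simp: monotone_on_def less_eq_real_def)
    have "(f \<longlongrightarrow> 0) at_bot"
      unfolding f_def log_lambert_fun_def[abs_def] using B by real_asymp
    then have near: "eventually (\<lambda>y. x < f y \<and> y \<le> d1) at_bot" if "x < 0" for x
      using that by (intro eventually_conj order_tendstoD eventually_le_at_bot) auto
    show "\<exists>v\<in>{..d1}. x \<le> f v" if x: "x \<in> {f d1..<0}" for x
    proof -
      obtain v where "x < f v \<and> v \<le> d1"
        using eventually_happens'[OF trivial_limit_at_bot_linorder near[of x]] x by auto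
      then show ?thesis by (intro bexI[of _ v]) auto
    qed
    show "\<exists>v\<in>{..d1}. f v \<le> x" if "x \<in> {f d1..<0}" for x
      using that by (intro bexI[of _ d1]) auto
  qed auto
  have subs: "{d2..<0} \<subseteq> log_lambert_dom B" "{d1..d2} \<subseteq> log_lambert_dom B" "{..d1} \<subseteq> log_lambert_dom B"
    using d(3) d12 by (auto simp: dom)
  obtain W0 where W0: "log_lambert_branch B W0 {0<..f d2} {d2..<0}" "strict_antimono_on {0<..f d2} W0"
    "\<And>x y. y \<in> {d2..<0} \<and> f y = x \<longleftrightarrow> x \<in> {0<..f d2} \<and> y = W0 x"
    using decreasing_branch[OF _ anti0[unfolded f_def] im0[unfolded f_def], folded f_def] subs by blast
  obtain W1 where W1: "log_lambert_branch B W1 {f d1..f d2} {d1..d2}" "strict_mono_on {f d1..f d2} W1"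
    "\<And>x y. y \<in> {d1..d2} \<and> f y = x \<longleftrightarrow> x \<in> {f d1..f d2} \<and> y = W1 x"
    using increasing_branch[OF _ mono1[unfolded f_def] im1[unfolded f_def], folded f_def] subs by blast
  obtain W2 where W2: "log_lambert_branch B W2 {f d1..<0} {..d1}" "strict_antimono_on {f d1..<0} W2"
    "\<And>x y. y \<in> {..d1} \<and> f y = x \<longleftrightarrow> x \<in> {f d1..<0} \<and> y = W2 x"
    using decreasing_branch[OF _ anti2[unfolded f_def] im2[unfolded f_def], folded f_def] subs by blast
  have cover: "(x \<in> {0<..f d2} \<and> y = W0 x) \<or> (x \<in> {f d1..f d2} \<and> y = W1 x) \<or>
      (x \<in> {f d1..<0} \<and> y = W2 x) \<longleftrightarrow> y \<in> log_lambert B x" for x y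
    unfolding W0(3)[symmetric] W1(3)[symmetric] W2(3)[symmetric]
    using d12 d(3) by (auto simp: log_lambert_def dom f_def)
  show ?thesis
    by (rule exI[of _ d1], rule exI[of _ d2], rule conjI[OF crit], rule conjI[OF d(1)],
        rule conjI[OF d(2)], rule conjI[OF d(3)],
        rule exI[of _ W0], rule exI[of _ W1], rule exI[of _ W2],
        rule conjI[OF W0(1)], rule conjI[OF W0(2)], rule conjI[OF W1(1)], rule conjI[OF W1(2)],
        rule conjI[OF W2(1)], rule conjI[OF W2(2)], (rule allI)+, rule cover[symmetric])
qed

theorem theorem2p6:
  fixes B :: real
  assumes "B \<noteq> 0"
  defines "f \<equiv> log_lambert_fun B"
  shows
    "(B > 0 \<longrightarrow>
       (\<exists>\<delta>. {y \<in> log_lambert_dom B. (y + 1) * ln (B * y) = -1} = {\<delta>} \<and>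
         (\<exists>W0 W1.
            log_lambert_branch B W0 {f \<delta>..} {\<delta>..} \<and>
            strict_mono_on {f \<delta>..} W0 \<and>
            log_lambert_branch B W1 {f \<delta><..<0} {0<..<\<delta>} \<and>
            strict_antimono_on {f \<delta><..<0} W1 \<and>
            (\<forall>x y. y \<in> log_lambert B x \<longleftrightarrow>
               (x \<in> {f \<delta>..} \<and> y = W0 x) \<or>
               (x \<in> {f \<delta><..<0} \<and> y = W1 x))))) \<and>
     (B < 0 \<longrightarrow>
       (\<exists>\<delta>1 \<delta>2. {y \<in> log_lambert_dom B. (y + 1) * ln (B * y) = -1} = {\<delta>1, \<delta>2} \<and>
         \<delta>1 < 1 / B \<and> 1 / B < \<delta>2 \<and> \<delta>2 < 0 \<and>
         (\<exists>W0 W1 W2.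
            log_lambert_branch B W0 {0<..f \<delta>2} {\<delta>2..<0} \<and>
            strict_antimono_on {0<..f \<delta>2} W0 \<and>
            log_lambert_branch B W1 {f \<delta>1..f \<delta>2} {\<delta>1..\<delta>2} \<and>
            strict_mono_on {f \<delta>1..f \<delta>2} W1 \<and>
            log_lambert_branch B W2 {f \<delta>1..<0} {..\<delta>1} \<and>
            strict_antimono_on {f \<delta>1..<0} W2 \<and>
            (\<forall>x y. y \<in> log_lambert B x \<longleftrightarrow>
               (x \<in> {0<..f \<delta>2} \<and> y = W0 x) \<or>
               (x \<in> {f \<delta>1..f \<delta>2} \<and> y = W1 x) \<or>
               (x \<in> {f \<delta>1..<0} \<and> y = W2 x)))))"
  unfolding f_def
  by (rule conjI; rule impI) (erule branches_pos, erule branches_neg)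

end
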